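(* Let $I=[0,c]$, let $(\alpha,\kappa):I\rightarrow\mathbb{R}^2$ be a smooth function and fix $(p,v)\in X\times S$. Then there exists a unique Legendre curve $(\gamma,\eta):I\rightarrow X\times S$ whose curvature is $(\alpha,\kappa)$ and such that $\gamma(0)=p$ and $\eta(0)=v$.
   Context: Let $(X,\|\cdot\|)$ be a two-dimensional real normed space with unit circle $S=\{x\in X:\|x\|=1\}$. The plane is assumed smooth ($S$ is a smooth curve) and strictly convex ($S$ contains no line segment). Fix a nondegenerate symplectic (alternating) bilinear form $[\cdot,\cdot]$ on $X$. For $x,y\in X$, $x\dashv_B y$ (Birkhoff orthogonality) means $\|x+ty\|\ge\|x\|$ for all $t\in\mathbb{R}$. For $v\in X\setminus\{o\}$ let $b(v)\in S$ be the unique vector with $v\dashv_B b(v)$ and $[v,b(v)]>0$. A Legendre curve is a smooth map $(\gamma,\eta):I\rightarrow X\times S$ with $\eta(t)\dashv_B\gamma'(t)$ for all $t\in I$. Put $\xi(t)=b(\eta(t))$. There are smooth functions $\alpha,\kappa:I\to\mathbb{R}$ with $\gamma'(t)=\alpha(t)\xi(t)$ and $\eta'(t)=\kappa(t)\xi(t)$; the pair $(\alpha,\kappa)$ is called the curvature of the Legendre curve $(\gamma,\eta)$. *)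

theory Defs
  imports "HOL-Analysis.Analysis"
begin

section \<open>Smooth maps and smooth curves\<close>

text \<open>
  \<open>C\<^sup>\<infinity>\<close> on a set of reals, as the existence of the tower of all derivatives \<open>D n\<close>.
  Derivatives are taken within \<open>A\<close>, hence one-sided at the end points of a compact interval.
  The notion is only meaningful when \<open>A\<close> has no isolated points.
\<close>
definition smooth_on :: "real set \<Rightarrow> (real \<Rightarrow> 'a::real_normed_vector) \<Rightarrow> bool" where
  "smooth_on A f \<longleftrightarrow>
     (\<exists>D :: nat \<Rightarrow> real \<Rightarrow> 'a. (\<forall>t\<in>A. D 0 t = f t) \<and>
        (\<forall>n. \<forall>t\<in>A. (D n has_vector_derivative D (Suc n) t) (at t within A)))"

text \<open>
  A smooth curve as a point set, i.e. an embedded one-dimensional \<open>C\<^sup>\<infinity>\<close> submanifold: near each of its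
  points it is homeomorphically parametrized by a regular \<open>C\<^sup>\<infinity>\<close> map of an open interval.
\<close>
definition smooth_curve :: "'a::real_normed_vector set \<Rightarrow> bool" where
  "smooth_curve C \<longleftrightarrow>
     (\<forall>x\<in>C. \<exists>U a b \<phi> \<psi>. open U \<and> x \<in> U \<and> a < b \<and> smooth_on {a<..<b} \<phi> \<and>
        (\<forall>s\<in>{a<..<b}. vector_derivative \<phi> (at s) \<noteq> 0) \<and>
        homeomorphism {a<..<b} (C \<inter> U) \<phi> \<psi>)"

section \<open>Normed planes\<close>

definition smooth_norm :: "'a::real_normed_vector itself \<Rightarrow> bool" where
  "smooth_norm _ \<longleftrightarrow> smooth_curve (sphere (0::'a) 1)"

definition strictly_convex_norm :: "'a::real_normed_vector itself \<Rightarrow> bool" where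
  "strictly_convex_norm _ \<longleftrightarrow>
     \<not> (\<exists>x y::'a. x \<noteq> y \<and> closed_segment x y \<subseteq> sphere 0 1)"

definition symplectic_form :: "('a::real_vector \<Rightarrow> 'a \<Rightarrow> real) \<Rightarrow> bool" where
  "symplectic_form \<omega> \<longleftrightarrow>
     bilinear \<omega> \<and> (\<forall>x. \<omega> x x = 0) \<and> (\<forall>x. x \<noteq> 0 \<longrightarrow> (\<exists>y. \<omega> x y \<noteq> 0))"

definition birkhoff_orth :: "'a::real_normed_vector \<Rightarrow> 'a \<Rightarrow> bool"  (infix "\<stileturn>\<^sub>B" 50) where
  "x \<stileturn>\<^sub>B y \<longleftrightarrow> (\<forall>t::real. norm (x + t *\<^sub>R y) \<ge> norm x)"

text \<open>For \<open>v \<noteq> 0\<close> in a smooth normed plane the description below has a unique solution.\<close>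
definition birkhoff_map :: "('a::real_normed_vector \<Rightarrow> 'a \<Rightarrow> real) \<Rightarrow> 'a \<Rightarrow> 'a" where
  "birkhoff_map \<omega> v = (THE w. w \<in> sphere 0 1 \<and> v \<stileturn>\<^sub>B w \<and> \<omega> v w > 0)"

section \<open>Legendre curves\<close>

definition legendre_curve ::
  "real set \<Rightarrow> (real \<Rightarrow> 'a::real_normed_vector) \<Rightarrow> (real \<Rightarrow> 'a) \<Rightarrow> bool" where
  "legendre_curve A \<gamma> \<eta> \<longleftrightarrow>
     smooth_on A \<gamma> \<and> smooth_on A \<eta> \<and> (\<forall>t\<in>A. \<eta> t \<in> sphere 0 1) \<and>
     (\<forall>t\<in>A. \<eta> t \<stileturn>\<^sub>B vector_derivative \<gamma> (at t within A))"

definition has_legendre_curvature ::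
  "('a::real_normed_vector \<Rightarrow> 'a \<Rightarrow> real) \<Rightarrow> real set \<Rightarrow> (real \<Rightarrow> 'a) \<Rightarrow> (real \<Rightarrow> 'a) \<Rightarrow>
     (real \<Rightarrow> real) \<Rightarrow> (real \<Rightarrow> real) \<Rightarrow> bool" where
  "has_legendre_curvature \<omega> A \<gamma> \<eta> \<alpha> \<kappa> \<longleftrightarrow>
     (\<forall>t\<in>A. vector_derivative \<gamma> (at t within A) = \<alpha> t *\<^sub>R birkhoff_map \<omega> (\<eta> t) \<and>
            vector_derivative \<eta> (at t within A) = \<kappa> t *\<^sub>R birkhoff_map \<omega> (\<eta> t))"

end

theory Submission
  imports Defs
begin

text \<open>
  The curvature equations decouple: first \<open>\<eta>' = \<kappa> b(\<eta>)\<close> on the unit circle, where \<open>b\<close> denotes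
  \<open>birkhoff_map \<omega>\<close>, and then \<open>\<gamma>' = \<alpha> b(\<eta>)\<close>, which is a plain integration. The first equation is a
  motion along a fixed curve with prescribed speed, so no general existence theory for differential
  equations is needed once the unit circle has a good global parametrization.

  Choose a basis of the plane that is positively oriented for \<open>\<omega>\<close>; it identifies the plane with the
  complex numbers (\<open>plane_has_coordinates\<close>). The unit circle is then parametrized by the angle,
  \<open>circle \<theta> = radial \<theta> \<cdot> cis \<theta>\<close> with \<open>radial \<theta>\<close> the reciprocal of the norm of \<open>cis \<theta>\<close>. The heart of the
  proof is that \<open>radial\<close> is smooth (\<open>radial_smooth\<close>). A regular chart of the circle has a smooth polar
  angle, because a nonvanishing smooth complex curve has a smooth logarithm. The derivative of this
  angle cannot vanish: otherwise the chart would move radially, whereas the tangent of the unit circle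
  at a point \<open>v\<close> is Birkhoff orthogonal to \<open>v\<close> and so not parallel to it. Hence the angle can be
  inverted smoothly, and the angle itself becomes a smooth local parameter.

  A direction that is Birkhoff orthogonal to a point of the circle is tangent there, so \<open>b(circle \<theta>)\<close>
  is the unit tangent and \<open>circle' = speed \<cdot> b(circle)\<close> (\<open>birkhoff_map_tangent\<close>, \<open>circle_speed\<close>). The
  speed is smooth since the norm of a smooth nonvanishing curve can be written in terms of \<open>radial\<close> and
  the polar angle, and it is bounded away from 0, so a primitive \<open>L\<close> of it is a smooth bijection of the
  line with smooth inverse (\<open>primitive_inverse\<close>). For \<open>\<eta> = circle \<circ> \<tau>\<close> the equation \<open>\<eta>' = \<kappa> b(\<eta>)\<close> says
  \<open>(L \<circ> \<tau>)' = \<kappa>\<close>. This determines \<open>\<tau>\<close> from its initial value, and also provides it. Since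
  every smooth curve on the circle lifts to a smooth angle \<open>\<tau>\<close> (\<open>sphere_curve_lift\<close>), existence and
  uniqueness both follow (\<open>spherical_curve_with_given_speed\<close>).
\<close>

section \<open>Smooth functions on subsets of the line\<close>

text \<open>
  Orders of differentiability are counted one at a time so that closure properties (products,
  compositions, inverses) follow by induction on the order; the tower of derivatives in \<open>smooth_on\<close>
  would require an explicit formula for all higher derivatives. Order 0 is the void condition, so
  that order \<open>n\<close> means exactly \<open>n\<close> derivatives.
\<close>
primrec diff_times_on :: "nat \<Rightarrow> real set \<Rightarrow> (real \<Rightarrow> 'a::real_normed_vector) \<Rightarrow> bool" where
  "diff_times_on 0 A f \<longleftrightarrow> True"
| "diff_times_on (Suc n) A f \<longleftrightarrow>
     (\<exists>f'. (\<forall>t\<in>A. (f has_vector_derivative f' t) (at t within A)) \<and> diff_times_on n A f')"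

lemma diff_times_on_cong:
  assumes "diff_times_on n A f" "\<And>t. t \<in> A \<Longrightarrow> f t = g t"
  shows "diff_times_on n A g"
proof (cases n)
  case (Suc m)
  with assms(1) obtain f' where
    "\<forall>t\<in>A. (f has_vector_derivative f' t) (at t within A)" "diff_times_on m A f'" by auto
  then have "\<forall>t\<in>A. (g has_vector_derivative f' t) (at t within A)"
    using assms(2) has_vector_derivative_transform by metis
  then show ?thesis using Suc \<open>diff_times_on m A f'\<close> by auto
qed simp

lemma diff_times_on_SucD: "diff_times_on (Suc n) A f \<Longrightarrow> diff_times_on n A f"
proof (induction n arbitrary: f)
  case (Suc n)
  then obtain f' where
    "\<forall>t\<in>A. (f has_vector_derivative f' t) (at t within A)" "diff_times_on (Suc n) A f'"
    by (auto simp only: diff_times_on.simps(2)[of "Suc n"])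
  then show ?case using Suc.IH[of f'] by auto
qed simp

lemma diff_times_on_SucI:
  assumes "\<And>t. t \<in> A \<Longrightarrow> (f has_vector_derivative f' t) (at t within A)" "diff_times_on n A f'"
  shows "diff_times_on (Suc n) A f"
  using assms by auto

lemma smooth_on_imp_diff_times_on:
  assumes "smooth_on A f"
  shows "diff_times_on n A f"
proof -
  obtain D where D: "\<forall>t\<in>A. D 0 t = f t"
    "\<And>n t. t \<in> A \<Longrightarrow> (D n has_vector_derivative D (Suc n) t) (at t within A)"
    using assms unfolding smooth_on_def by blast
  have "diff_times_on n A (D m)" for m
    by (induction n arbitrary: m) (auto intro!: D(2))
  then show ?thesis using D(1) diff_times_on_cong by blast
qed

text \<open>
  Without isolated points the derivative within \<open>A\<close> is unique. The witnesses for the different orders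
  therefore agree and form a single tower, obtained by iterating \<open>vector_derivative\<close>.
\<close>
lemma diff_times_on_imp_smooth_on:
  assumes lim: "\<And>t. t \<in> A \<Longrightarrow> t islimpt A"
    and ck: "\<And>n. diff_times_on n A f"
  shows "smooth_on A f"
proof -
  define D where "D n = ((\<lambda>h t. vector_derivative h (at t within A)) ^^ n) f" for n
  have vd: "vector_derivative h (at t within A) = h'"
    if "(h has_vector_derivative h') (at t within A)" "t \<in> A" for t h' and h :: "real \<Rightarrow> 'a"
    using lim[OF that(2)] that(1) by (meson trivial_limit_within vector_derivative_within)
  have ckD: "diff_times_on m A (D n)" for n m
  proof (induction n arbitrary: m)
    case 0
    then show ?case using ck by (simp add: D_def)
  next
    case (Suc n)
    from Suc[of "Suc m"] obtain f' where
      f': "\<forall>t\<in>A. (D n has_vector_derivative f' t) (at t within A)" "diff_times_on m A f'" by auto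
    then have "f' t = D (Suc n) t" if "t \<in> A" for t
      using vd[of "D n" "f' t" t] that by (simp add: D_def)
    then show ?case using f'(2) diff_times_on_cong by blast
  qed
  have "(D n has_vector_derivative D (Suc n) t) (at t within A)" if "t \<in> A" for n t
  proof -
    from ckD[of "Suc 0" n] obtain f' where "\<forall>t\<in>A. (D n has_vector_derivative f' t) (at t within A)"
      by auto
    then have d: "(D n has_vector_derivative f' t) (at t within A)" using that by blast
    then show ?thesis using vd[OF d that] by (simp add: D_def)
  qed
  then show ?thesis unfolding smooth_on_def by (intro exI[of _ D]) (simp add: D_def)
qed

lemma diff_times_on_const: "diff_times_on n A (\<lambda>t. k)"
  by (induction n arbitrary: k) (auto intro!: exI[of _ "\<lambda>t. 0"] derivative_eq_intros)

lemma diff_times_on_add: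
  "diff_times_on n A f \<Longrightarrow> diff_times_on n A g \<Longrightarrow> diff_times_on n A (\<lambda>t. f t + g t)"
proof (induction n arbitrary: f g)
  case (Suc n)
  then obtain f' g' where
    "\<forall>t\<in>A. (f has_vector_derivative f' t) (at t within A)" "diff_times_on n A f'"
    "\<forall>t\<in>A. (g has_vector_derivative g' t) (at t within A)" "diff_times_on n A g'" by auto
  then show ?case using Suc.IH[of f' g']
    by (intro diff_times_on_SucI[of _ _ "\<lambda>t. f' t + g' t"]) (auto intro!: has_vector_derivative_add)
qed simp

lemma diff_times_on_bilinear:
  assumes "bounded_bilinear bil"
  shows "diff_times_on n A f \<Longrightarrow> diff_times_on n A g \<Longrightarrow> diff_times_on n A (\<lambda>t. bil (f t) (g t))"
proof (induction n arbitrary: f g)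
  case (Suc n)
  then obtain f' g' where fg:
    "\<forall>t\<in>A. (f has_vector_derivative f' t) (at t within A)" "diff_times_on n A f'"
    "\<forall>t\<in>A. (g has_vector_derivative g' t) (at t within A)" "diff_times_on n A g'" by auto
  have "diff_times_on n A (\<lambda>t. bil (f t) (g' t) + bil (f' t) (g t))"
    using fg Suc.prems[THEN diff_times_on_SucD] by (intro diff_times_on_add Suc.IH)
  then show ?case using fg bounded_bilinear.has_vector_derivative[OF assms]
    by (intro diff_times_on_SucI[of _ _ "\<lambda>t. bil (f t) (g' t) + bil (f' t) (g t)"]) auto
qed simp

lemma diff_times_on_linear:
  assumes "bounded_linear T"
  shows "diff_times_on n A f \<Longrightarrow> diff_times_on n A (\<lambda>t. T (f t))"
proof (induction n arbitrary: f)
  case (Suc n)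
  then obtain f' where
    "\<forall>t\<in>A. (f has_vector_derivative f' t) (at t within A)" "diff_times_on n A f'" by auto
  then show ?case using Suc.IH[of f'] bounded_linear.has_vector_derivative[OF assms]
    by (intro diff_times_on_SucI[of _ _ "\<lambda>t. T (f' t)"]) auto
qed simp

lemma diff_times_on_compose:
  assumes "s ` A \<subseteq> B"
  shows "diff_times_on n B f \<Longrightarrow> diff_times_on n A s \<Longrightarrow> diff_times_on n A (\<lambda>t. f (s t))"
proof (induction n arbitrary: f)
  case (Suc n)
  then obtain f' s' where fs:
    "\<forall>t\<in>B. (f has_vector_derivative f' t) (at t within B)" "diff_times_on n B f'"
    "\<forall>t\<in>A. (s has_vector_derivative s' t) (at t within A)" "diff_times_on n A s'" by auto
  have "diff_times_on n A (\<lambda>t. s' t *\<^sub>R f' (s t))"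
    using Suc.IH fs Suc.prems diff_times_on_SucD
    by (intro diff_times_on_bilinear[OF bounded_bilinear_scaleR]) blast+
  moreover have "((\<lambda>t. f (s t)) has_vector_derivative s' t *\<^sub>R f' (s t)) (at t within A)"
    if "t \<in> A" for t
  proof -
    have "(f has_vector_derivative f' (s t)) (at (s t) within s ` A)"
      using fs(1) assms that by (meson has_vector_derivative_within_subset image_subset_iff)
    from vector_diff_chain_within[OF _ this] show ?thesis using fs(3) that by (simp add: o_def)
  qed
  ultimately show ?case by (rule diff_times_on_SucI[rotated])
qed simp

lemma diff_times_on_inverse:
  fixes f :: "real \<Rightarrow> 'a::real_normed_field"
  assumes "\<And>t. t \<in> A \<Longrightarrow> f t \<noteq> 0"
  shows "diff_times_on n A f \<Longrightarrow> diff_times_on n A (\<lambda>t. inverse (f t))"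
proof (induction n)
  case (Suc n)
  then obtain f' where f':
    "\<forall>t\<in>A. (f has_vector_derivative f' t) (at t within A)" "diff_times_on n A f'" by auto
  have "diff_times_on n A (\<lambda>t. inverse (f t))" using Suc diff_times_on_SucD by blast
  then have "diff_times_on n A (\<lambda>t. - (inverse (f t) * f' t * inverse (f t)))"
    using f'(2) by (intro diff_times_on_linear[OF bounded_linear_minus[OF bounded_linear_ident]]
      diff_times_on_bilinear[OF bounded_bilinear_mult])
  moreover have "((\<lambda>t. inverse (f t)) has_vector_derivative
      - (inverse (f t) * f' t * inverse (f t))) (at t within A)" if "t \<in> A" for t
    using Deriv.has_derivative_inverse[where f = f and x = t, OF assms[OF that], of "\<lambda>h. h *\<^sub>R f' t" A] f'(1) that
    by (simp add: has_vector_derivative_def)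
  ultimately show ?case by (rule diff_times_on_SucI[rotated])
qed simp

text \<open>
  On open sets the derivative does not depend on the set within which it is taken, so the global
  function \<open>vector_derivative f\<close> glues the local derivatives.
\<close>
lemma diff_times_on_local:
  assumes "\<And>x. \<exists>V. open V \<and> x \<in> V \<and> diff_times_on n V f"
  shows "diff_times_on n UNIV f"
  using assms
proof (induction n arbitrary: f)
  case (Suc n)
  define f' where "f' t = vector_derivative f (at t)" for t
  have *: "\<exists>V. open V \<and> x \<in> V \<and> diff_times_on n V f' \<and>
      (\<forall>t\<in>V. (f has_vector_derivative f' t) (at t))" for x
  proof -
    obtain V d where V: "open V" "x \<in> V" "\<forall>t\<in>V. (f has_vector_derivative d t) (at t within V)"
      "diff_times_on n V d" using Suc.prems[of x] by auto
    then have fd: "(f has_vector_derivative d t) (at t)" if "t \<in> V" for t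
      using V(3) that at_within_open[OF that V(1)] by metis
    then have "d t = f' t" if "t \<in> V" for t
      using that by (metis f'_def vector_derivative_at)
    then show ?thesis using V fd diff_times_on_cong by metis
  qed
  then have "diff_times_on n UNIV f'" using Suc.IH[of f'] by blast
  then show ?case using * by (intro diff_times_on_SucI[of _ _ f']) auto
qed simp

lemma islimpt_interval:
  fixes t :: real
  shows "open A \<Longrightarrow> t \<in> A \<Longrightarrow> t islimpt A"
    and "a < b \<Longrightarrow> t \<in> {a..b} \<Longrightarrow> t islimpt {a..b}"
  by (auto simp: open_imp_islimpt)

abbreviation inf_diff_on :: "real set \<Rightarrow> (real \<Rightarrow> 'a::real_normed_vector) \<Rightarrow> bool" where
  "inf_diff_on A f \<equiv> \<forall>n. diff_times_on n A f"

lemma inf_diff_onE: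
  assumes "inf_diff_on A f"
  obtains f' where "\<And>t. t \<in> A \<Longrightarrow> (f has_vector_derivative f' t) (at t within A)"
  using assms[rule_format, of "Suc 0"] by auto

lemma inf_diff_on_continuous: "inf_diff_on A f \<Longrightarrow> continuous_on A f"
  by (meson continuous_on_vector_derivative inf_diff_onE)

lemma inf_diff_on_iff: "(\<And>t. t \<in> A \<Longrightarrow> t islimpt A) \<Longrightarrow> smooth_on A f \<longleftrightarrow> inf_diff_on A f"
  using smooth_on_imp_diff_times_on diff_times_on_imp_smooth_on by blast

lemma inf_diff_on_deriv:
  assumes "\<And>t. t \<in> A \<Longrightarrow> t islimpt A" "inf_diff_on A f"
    "\<And>t. t \<in> A \<Longrightarrow> (f has_vector_derivative f' t) (at t within A)"
  shows "inf_diff_on A f'"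
proof
  fix n
  obtain f'' where f'': "\<forall>t\<in>A. (f has_vector_derivative f'' t) (at t within A)" "diff_times_on n A f''"
    using assms(2)[rule_format, of "Suc n"] by auto
  then have "f'' t = f' t" if "t \<in> A" for t
    using that assms(1,3) by (meson trivial_limit_within vector_derivative_unique_within)
  then show "diff_times_on n A f'" using f'' diff_times_on_cong by blast
qed

lemma inf_diff_on_if_deriv:
  assumes "\<And>t. t \<in> A \<Longrightarrow> (f has_vector_derivative f' t) (at t within A)" "inf_diff_on A f'"
  shows "inf_diff_on A f"
proof
  fix n show "diff_times_on n A f"
    using diff_times_on_SucI[OF assms(1)] assms(2) diff_times_on_SucD by blast
qed

text \<open>
  Bootstrapping: if \<open>s' = F \<circ> s\<close> with smooth \<open>F\<close>, then \<open>s\<close> always has one derivative more than has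
  been established for it.
\<close>
lemma inf_diff_on_ODE:
  assumes "inf_diff_on B F" "\<And>t. t \<in> A \<Longrightarrow> s t \<in> B"
    "\<And>t. t \<in> A \<Longrightarrow> (s has_vector_derivative F (s t)) (at t within A)"
  shows "inf_diff_on A s"
proof
  fix n show "diff_times_on n A s"
  proof (induction n)
    case (Suc n)
    show ?case using assms Suc
      by (intro diff_times_on_SucI[OF assms(3)] diff_times_on_compose[of s A B _ F]) auto
  qed simp
qed

text \<open>
  One statement for both uses: \<open>k = 1\<close> is the real exponential, \<open>k = \<i>\<close> is \<open>cis\<close>.
\<close>
lemma inf_diff_on_exp_linear:
  fixes k :: "'a::{real_normed_field,banach}"
  shows "inf_diff_on A (\<lambda>t. exp (of_real t * k))"
proof
  fix n
  have "diff_times_on n A (\<lambda>t. exp (of_real t * k) * m)" for m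
  proof (induction n arbitrary: m)
    case (Suc n)
    have "((\<lambda>t. exp (of_real t * k) * m) has_vector_derivative exp (of_real t * k) * (k * m)) (at t within A)" for t
      by (rule derivative_eq_intros has_vector_derivative_real_field | simp)+
    then show ?case using Suc by (intro diff_times_on_SucI)
  qed simp
  from this[of 1] show "diff_times_on n A (\<lambda>t. exp (of_real t * k))" by simp
qed

lemma inf_diff_on_exp:
  fixes f :: "real \<Rightarrow> real"
  assumes "inf_diff_on A f"
  shows "inf_diff_on A (\<lambda>t. exp (f t))"
proof
  fix n
  have "diff_times_on n UNIV (\<lambda>x::real. exp x)"
    using inf_diff_on_exp_linear[of UNIV "1::real"] by simp
  from diff_times_on_compose[OF subset_UNIV this assms[rule_format]]
  show "diff_times_on n A (\<lambda>t. exp (f t))" .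
qed

text \<open>
  A continuous logarithm exists because a convex set is contractible. Near each point it differs by a
  constant from the principal logarithm of \<open>z s / z t\<close>, which is close to 1, so it is differentiable
  with the smooth derivative \<open>z' / z\<close>.
\<close>
lemma smooth_logarithm:
  fixes z :: "real \<Rightarrow> complex"
  assumes conv: "convex A" and lim: "\<And>t. t \<in> A \<Longrightarrow> t islimpt A"
    and z: "inf_diff_on A z" and nz: "\<And>t. t \<in> A \<Longrightarrow> z t \<noteq> 0"
  obtains l where "inf_diff_on A l" "\<And>t. t \<in> A \<Longrightarrow> z t = exp (l t)"
proof -
  obtain l where l: "continuous_on A l" "\<And>t. t \<in> A \<Longrightarrow> z t = exp (l t)"
    using continuous_logarithm_on_contractible[OF inf_diff_on_continuous[OF z] convex_imp_contractible[OF conv]]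
      nz by blast
  obtain z' where z': "\<And>t. t \<in> A \<Longrightarrow> (z has_vector_derivative z' t) (at t within A)"
    using inf_diff_onE[OF z] by blast
  have "(l has_vector_derivative z' t * inverse (z t)) (at t within A)" if t: "t \<in> A" for t
  proof -
    obtain \<delta> where \<delta>: "\<delta> > 0" "\<And>s. s \<in> A \<Longrightarrow> dist s t < \<delta> \<Longrightarrow> dist (l s) (l t) < pi"
      using l(1) t pi_gt_zero unfolding continuous_on_iff by metis
    have eq: "l t + Ln (z s / z t) = l s" if s: "s \<in> A" "dist s t < \<delta>" for s
    proof -
      have "\<bar>Im (l s - l t)\<bar> < pi"
        using \<delta>(2)[OF s] abs_Im_le_cmod[of "l s - l t"] by (simp add: dist_norm)
      then have "Ln (exp (l s - l t)) = l s - l t" by (intro Ln_exp) auto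
      then show ?thesis using l(2) s t by (simp add: exp_diff)
    qed
    have 1: "((\<lambda>s. z s / z t) has_vector_derivative z' t * inverse (z t)) (at t within A)"
      using z'[OF t] by (auto intro!: derivative_eq_intros simp: divide_inverse)
    have 2: "(Ln has_field_derivative 1) (at (z t / z t) within (\<lambda>s. z s / z t) ` A)"
      using has_field_derivative_Ln[of 1] nz[OF t] by (auto intro: has_field_derivative_at_within)
    have "((\<lambda>s. l t + Ln (z s / z t)) has_vector_derivative z' t * inverse (z t)) (at t within A)"
      using field_vector_diff_chain_within[OF 1 2]
      by (auto intro!: derivative_eq_intros simp: o_def)
    then show ?thesis
      by (rule has_vector_derivative_transform_within[OF _ \<delta>(1) t eq])
  qed
  moreover have "inf_diff_on A (\<lambda>t. z' t * inverse (z t))"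
    using inf_diff_on_deriv[OF lim z z'] z nz
    by (auto intro!: diff_times_on_bilinear[OF bounded_bilinear_mult] diff_times_on_inverse)
  ultimately have "inf_diff_on A l" by (rule inf_diff_on_if_deriv)
  then show ?thesis using that l by blast
qed

text \<open>
  The inverse function theorem in the form needed here: a continuous right inverse \<open>s\<close> satisfies
  \<open>s' = 1 / f' \<circ> s\<close>, an autonomous equation to which \<open>inf_diff_on_ODE\<close> applies.
\<close>
lemma smooth_right_inverse:
  fixes f s :: "real \<Rightarrow> real"
  assumes A: "open A" "inf_diff_on A f" "\<And>x. x \<in> A \<Longrightarrow> (f has_real_derivative f' x) (at x)"
    and nz: "\<And>x. x \<in> A \<Longrightarrow> f' x \<noteq> 0"
    and V: "open V" "continuous_on V s" "\<And>y. y \<in> V \<Longrightarrow> s y \<in> A" "\<And>y. y \<in> V \<Longrightarrow> f (s y) = y"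
  shows "inf_diff_on V s"
    and "\<And>y. y \<in> V \<Longrightarrow> (s has_real_derivative inverse (f' (s y))) (at y)"
proof -
  show der: "(s has_real_derivative inverse (f' (s y))) (at y)" if y: "y \<in> V" for y
  proof -
    obtain \<rho> where r: "\<rho> > 0" "ball y \<rho> \<subseteq> V" using V(1) openE y by blast
    show "(s has_real_derivative inverse (f' (s y))) (at y)"
    proof (rule DERIV_inverse_function[where f = f and g = s and x = y and a = "y - \<rho>" and b = "y + \<rho>"])
      show "(f has_real_derivative f' (s y)) (at (s y))" "f' (s y) \<noteq> 0" using A(3) nz V(3)[OF y] by blast+
      show "y - \<rho> < y" "y < y + \<rho>" using r by auto
      show "f (s x) = x" if "y - \<rho> < x" "x < y + \<rho>" for x
        using r that by (intro V(4)) (auto simp: dist_norm subset_iff abs_if)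
      show "isCont s y" using V(1,2) y by (simp add: continuous_on_eq_continuous_at)
    qed
  qed
  have "inf_diff_on A f'"
    using A(3) by (intro inf_diff_on_deriv[OF islimpt_interval(1)[OF A(1)] A(2)])
      (auto simp: has_real_derivative_iff_has_vector_derivative intro: has_vector_derivative_at_within)
  then have inv: "inf_diff_on A (\<lambda>x. inverse (f' x))" using nz diff_times_on_inverse by blast
  have der': "(s has_vector_derivative inverse (f' (s y))) (at y within V)" if "y \<in> V" for y
    using der[OF that]
    by (simp add: has_real_derivative_iff_has_vector_derivative has_vector_derivative_at_within)
  show "inf_diff_on V s" using V(3) by (rule inf_diff_on_ODE[OF inv _ der'])
qed

text \<open>
  A lower bound \<open>m > 0\<close> for the derivative makes the primitive grow at least linearly in both
  directions, which gives surjectivity; positivity alone would not.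
\<close>
lemma primitive_inverse:
  fixes f :: "real \<Rightarrow> real"
  assumes f: "inf_diff_on UNIV f" and m: "m > 0" "\<And>x. f x \<ge> m"
  obtains F G where "\<And>x. (F has_real_derivative f x) (at x)" "\<And>y. F (G y) = y" "\<And>x. G (F x) = x"
    "inf_diff_on UNIV G" "\<And>y. (G has_real_derivative inverse (f (G y))) (at y)"
proof -
  have "isCont f x" for x
    using inf_diff_on_continuous[OF f] by (simp add: continuous_on_eq_continuous_at)
  then obtain F where F': "\<And>x. (F has_real_derivative f x) (at x)"
    using einterval_antiderivative[of "-\<infinity>" \<infinity> f] by (auto simp: has_real_derivative_iff_has_vector_derivative)
  have pos: "f x > 0" for x using m less_le_trans by blast
  have F: "inf_diff_on UNIV F"
    using inf_diff_on_if_deriv[OF _ f] F' by (simp add: has_real_derivative_iff_has_vector_derivative)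
  have Fc: "isCont F x" for x using F' DERIV_isCont by blast
  have less: "F x < F y" if "x < y" for x y
    using DERIV_pos_imp_increasing[OF that] F' pos by blast
  have growth: "F x + m * (y - x) \<le> F y" if "x \<le> y" for x y
  proof -
    have "((\<lambda>x. F x - m * x) has_real_derivative f t - m) (at t)" for t
      using F'[of t] by (auto intro!: derivative_eq_intros)
    then have "F x - m * x \<le> F y - m * y"
      using DERIV_nonneg_imp_nondecreasing[OF that, of "\<lambda>x. F x - m * x"] m(2) by (metis diff_ge_0_iff_ge)
    then show ?thesis by (simp add: algebra_simps)
  qed
  have "\<exists>x. F x = y" for y
  proof -
    define r where "r = \<bar>y - F 0\<bar> / m"
    have r: "r \<ge> 0" "m * r = \<bar>y - F 0\<bar>" using m(1) by (simp_all add: r_def)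
    have "F (- r) \<le> y" "y \<le> F r" using growth[of "-r" 0] growth[of 0 r] r by auto
    then show ?thesis using IVT[of F "-r" y r] r Fc by auto
  qed
  then obtain G where FG: "\<And>y. F (G y) = y" by metis
  have GF: "G (F x) = x" for x using less FG by (metis linorder_neq_iff)
  have "isCont G (F x)" for x by (rule isCont_inverse_function[where f = F and d = 1]) (auto simp: GF Fc)
  then have "isCont G y" for y by (metis FG)
  then have Gc: "continuous_on UNIV G" by (simp add: continuous_at_imp_continuous_on)
  have nz: "f x \<noteq> 0" for x using pos[of x] by simp
  note G = smooth_right_inverse[where f = F and f' = f and s = G and A = UNIV and V = UNIV]
  show ?thesis
  proof (rule that[of F G])
    show "inf_diff_on UNIV G" by (rule G(1)) (auto simp: F F' nz Gc FG)
    show "(G has_real_derivative inverse (f (G y))) (at y)" for y by (rule G(2)) (auto simp: F F' nz Gc FG)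
  qed (rule F' FG GF)+
qed

section \<open>Birkhoff orthogonality and coordinates in a plane\<close>

text \<open>
  If the tangent line entered the open unit ball at \<open>\<phi> s + t u\<close>, then by convexity the
  points \<open>\<phi> s + h u\<close> would lie inside the ball at a depth proportional to \<open>\<bar>h\<bar>\<close>, for small \<open>h\<close> of the
  sign of \<open>t\<close>. The curve deviates from its tangent only by \<open>o(h)\<close>, so it would enter the ball as well.
\<close>
lemma curve_on_sphere_birkhoff_orth:
  assumes \<phi>: "(\<phi> has_vector_derivative u) (at s)"
    and V: "open V" "s \<in> V" "\<And>t. t \<in> V \<Longrightarrow> \<phi> t \<in> sphere 0 1"
  shows "\<phi> s \<stileturn>\<^sub>B u"
  unfolding birkhoff_orth_def
proof (rule allI, rule ccontr)
  fix t assume "\<not> norm (\<phi> s) \<le> norm (\<phi> s + t *\<^sub>R u)"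
  then have lt: "norm (\<phi> s + t *\<^sub>R u) < 1" using V by auto
  then have t0: "t \<noteq> 0" using V by auto
  \<comment> \<open>half the rate at which convexity pushes the tangent line into the ball\<close>
  define \<epsilon> where "\<epsilon> = (1 - norm (\<phi> s + t *\<^sub>R u)) / (2 * \<bar>t\<bar>)"
  have e0: "\<epsilon> > 0" using lt t0 by (simp add: \<epsilon>_def)
  obtain \<delta> where d: "\<delta> > 0" "\<And>y. norm (y - s) < \<delta> \<Longrightarrow>
      norm (\<phi> y - \<phi> s - (y - s) *\<^sub>R u) \<le> \<epsilon> * norm (y - s)"
    using \<phi> e0 unfolding has_vector_derivative_def has_derivative_at_alt by meson
  obtain \<rho> where r: "\<rho> > 0" "ball s \<rho> \<subseteq> V" using V openE by blast
  define q where "q = min (1/2) (min \<delta> \<rho> / (2 * \<bar>t\<bar>))"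
  have q: "0 < q" "q < 1" "q * \<bar>t\<bar> < \<delta>" "q * \<bar>t\<bar> < \<rho>"
    using t0 d r by (auto simp: q_def min_def field_simps)
  define h where "h = q * t"
  have h: "\<bar>h\<bar> < \<delta>" "\<bar>h\<bar> < \<rho>" using q by (auto simp: h_def abs_mult)
  have "\<phi> (s + h) = (\<phi> (s+h) - \<phi> s - h *\<^sub>R u) + ((1 - q) *\<^sub>R \<phi> s + q *\<^sub>R (\<phi> s + t *\<^sub>R u))"
    by (simp add: h_def algebra_simps)
  then have "norm (\<phi> (s + h)) \<le> norm (\<phi> (s+h) - \<phi> s - h *\<^sub>R u)
      + (norm ((1 - q) *\<^sub>R \<phi> s) + norm (q *\<^sub>R (\<phi> s + t *\<^sub>R u)))"
    by (metis norm_triangle_le add_left_mono norm_triangle_ineq)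
  also have "\<dots> \<le> \<epsilon> * \<bar>h\<bar> + ((1 - q) + q * norm (\<phi> s + t *\<^sub>R u))"
    using d(2)[of "s + h"] h q V by auto
  also have "\<dots> = 1 - q * (1 - norm (\<phi> s + t *\<^sub>R u)) / 2"
    using t0 q by (simp add: \<epsilon>_def h_def abs_mult field_simps)
  also have "\<dots> < 1" using q lt by simp
  finally have "norm (\<phi> (s + h)) < 1" .
  moreover have "s + h \<in> V" using r h by (auto simp: dist_norm subset_iff)
  ultimately show False using V(3)[of "s+h"] by auto
qed

lemma birkhoff_orth_scaleR: "x \<stileturn>\<^sub>B y \<Longrightarrow> x \<stileturn>\<^sub>B r *\<^sub>R y"
  by (simp add: birkhoff_orth_def)

lemma parallel_complex:
  assumes "Im (cnj a * b) = 0" "b \<noteq> 0"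
  obtains k :: real where "a = of_real k * b"
proof -
  have "a * cnj b \<in> \<real>" using assms(1) by (simp add: complex_is_Real_iff algebra_simps)
  then obtain k where k: "a * cnj b = of_real k" by (auto elim: Reals_cases)
  have "a * (b * cnj b) = of_real k * b" using k by (simp add: mult.assoc[symmetric] mult.commute)
  then have "a * of_real ((cmod b)\<^sup>2) = of_real k * b" by (simp only: complex_norm_square)
  then have "a = of_real (k / (cmod b)\<^sup>2) * b" using assms(2) by (simp add: field_simps)
  then show ?thesis using that by blast
qed

lemma polar_form_unique:
  assumes "of_real r * cis a = of_real s * cis b" "r > 0" "s > 0"
  shows "r = s" "cis a = cis b"
proof -
  have "cmod (of_real r * cis a) = cmod (of_real s * cis b)" using assms(1) by (rule arg_cong)
  then show "r = s" using assms(2,3) by (simp add: norm_mult)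
  then show "cis a = cis b" using assms by simp
qed

text \<open>
  A plane identified with \<open>\<complex>\<close> by mutually inverse bounded linear maps \<open>J\<close> and \<open>H\<close>, under which
  \<open>\<omega>\<close> becomes a positive multiple of the determinant \<open>Im (cnj a * b)\<close>. The positive factor makes the
  orientation of \<open>\<omega>\<close> agree with the counterclockwise one, in which the angle increases.
\<close>
locale plane_coordinates =
  fixes \<omega> :: "'a::real_normed_vector \<Rightarrow> 'a \<Rightarrow> real"
    and J :: "complex \<Rightarrow> 'a" and H :: "'a \<Rightarrow> complex" and d :: real
  assumes J: "bounded_linear J" and H: "bounded_linear H"
    and HJ [simp]: "H (J z) = z" and JH [simp]: "J (H x) = x"
    and d: "d > 0" and \<omega>: "\<omega> x y = d * Im (cnj (H x) * H y)"
begin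

lemma coordinate_simps:
  "J (a + b) = J a + J b" "J (a - b) = J a - J b" "J (r *\<^sub>R a) = r *\<^sub>R J a" "J (of_real r * a) = r *\<^sub>R J a"
  "H (x + y) = H x + H y" "H (x - y) = H x - H y" "H (r *\<^sub>R x) = r *\<^sub>R H x"
  "J 0 = 0" "H 0 = 0"
  using J H by (simp_all add: bounded_linear.linear linear_add linear_diff linear_scale linear_0
      flip: scaleR_conv_of_real)

lemma J_eq_0 [simp]: "J z = 0 \<longleftrightarrow> z = 0" and H_eq_0 [simp]: "H x = 0 \<longleftrightarrow> x = 0"
  by (metis HJ JH coordinate_simps(8,9))+

lemma form_simps:
  "\<omega> (x - y) w = \<omega> x w - \<omega> y w" "\<omega> (r *\<^sub>R x) w = r * \<omega> x w" "\<omega> x (r *\<^sub>R w) = r * \<omega> x w"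
  "\<omega> x y = - \<omega> y x"
  by (simp_all add: \<omega> coordinate_simps algebra_simps)

lemma form_0_parallel:
  assumes "\<omega> x y = 0" "y \<noteq> 0"
  obtains k where "x = k *\<^sub>R y"
proof -
  obtain k :: real where "H x = of_real k * H y"
    using parallel_complex[of "H x" "H y"] assms d by (auto simp: \<omega>)
  then have "J (H x) = J (of_real k * H y)" by simp
  then have "x = k *\<^sub>R y" by (simp only: coordinate_simps JH)
  then show ?thesis by (rule that)
qed

lemma birkhoff_orth_imp_form_nz:
  assumes "x \<stileturn>\<^sub>B w" "x \<noteq> 0" "w \<noteq> 0"
  shows "\<omega> x w \<noteq> 0"
proof
  assume "\<omega> x w = 0"
  then obtain k where "x = k *\<^sub>R w" using form_0_parallel assms(3) by blast
  then show False using assms(1)[unfolded birkhoff_orth_def, rule_format, of "-k"] assms(2)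
    by (simp del: norm_scaleR)
qed

text \<open>
  The line \<open>v + \<real> w\<close> is the level set of \<open>\<omega> _ w\<close> through \<open>v\<close>, and Birkhoff orthogonality says that it
  avoids the open ball. A unit vector with a larger value of the form could be scaled down onto this
  line.
\<close>
lemma birkhoff_orth_maximizes_form:
  assumes v: "v \<in> sphere 0 1" "v \<stileturn>\<^sub>B w" "w \<noteq> 0" and x: "x \<in> sphere 0 1"
  shows "\<bar>\<omega> x w\<bar> \<le> \<bar>\<omega> v w\<bar>"
proof (rule ccontr)
  assume gt: "\<not> \<bar>\<omega> x w\<bar> \<le> \<bar>\<omega> v w\<bar>"
  define q where "q = \<omega> v w / \<omega> x w"
  have q: "\<bar>q\<bar> < 1" using gt by (simp add: q_def abs_divide divide_less_eq_1)
  have "\<omega> (q *\<^sub>R x - v) w = 0" using gt by (auto simp: form_simps(1,2) q_def)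
  then obtain k where "q *\<^sub>R x - v = k *\<^sub>R w" using form_0_parallel v(3) by blast
  then have "v + k *\<^sub>R w = q *\<^sub>R x" by (simp add: algebra_simps)
  then have "norm (v + k *\<^sub>R w) = \<bar>q\<bar>" using x by simp
  then show False using v q unfolding birkhoff_orth_def by (metis linorder_not_le mem_sphere_0)
qed

text \<open>
  By \<open>birkhoff_orth_maximizes_form\<close> the product \<open>\<omega> (\<phi> t) w * \<omega> (\<phi> s) w\<close> is maximal at \<open>t = s\<close>; the second
  factor spares a case distinction on the sign of \<open>\<omega> (\<phi> s) w\<close>. The derivative vanishes there.
\<close>
lemma birkhoff_orth_parallel_tangent:
  assumes \<phi>: "(\<phi> has_vector_derivative u) (at s)"
    and V: "open V" "s \<in> V" "\<And>t. t \<in> V \<Longrightarrow> \<phi> t \<in> sphere 0 1"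
    and w: "\<phi> s \<stileturn>\<^sub>B w" "w \<noteq> 0"
  shows "\<omega> u w = 0"
proof -
  obtain \<rho> where r: "\<rho> > 0" "ball s \<rho> \<subseteq> V" using V openE by blast
  have nz: "\<omega> (\<phi> s) w \<noteq> 0" using birkhoff_orth_imp_form_nz[OF w(1) _ w(2)] V(2,3) by force
  have bl: "bounded_linear (\<lambda>x. \<omega> x w)"
    unfolding \<omega> by (intro bounded_linear_intros bounded_linear_compose[OF _ H]
      bounded_linear_compose[OF bounded_linear_Im] bounded_linear_compose[OF bounded_linear_cnj H] bounded_linear_cnj)
  have "((\<lambda>t. \<omega> (\<phi> t) w) has_vector_derivative \<omega> u w) (at s)"
    using bounded_linear.has_vector_derivative[OF bl \<phi>] .
  then have "DERIV (\<lambda>t. \<omega> (\<phi> t) w * \<omega> (\<phi> s) w) s :> \<omega> u w * \<omega> (\<phi> s) w"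
    by (auto intro!: derivative_eq_intros simp: has_real_derivative_iff_has_vector_derivative)
  moreover have "\<omega> (\<phi> t) w * \<omega> (\<phi> s) w \<le> \<omega> (\<phi> s) w * \<omega> (\<phi> s) w" if "\<bar>s - t\<bar> < \<rho>" for t
  proof -
    have "t \<in> V" using that r by (auto simp: dist_norm subset_iff)
    then have "\<bar>\<omega> (\<phi> t) w\<bar> \<le> \<bar>\<omega> (\<phi> s) w\<bar>"
      using birkhoff_orth_maximizes_form[OF V(3)[OF V(2)] w] V(3) by blast
    then have "\<bar>\<omega> (\<phi> t) w\<bar> * \<bar>\<omega> (\<phi> s) w\<bar> \<le> \<bar>\<omega> (\<phi> s) w\<bar> * \<bar>\<omega> (\<phi> s) w\<bar>"
      by (rule mult_right_mono) simp
    then show ?thesis by (metis abs_le_D1 abs_mult abs_mult_self_eq)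
  qed
  ultimately have "\<omega> u w * \<omega> (\<phi> s) w = 0" using DERIV_local_max[OF _ r(1)] by blast
  then show ?thesis using nz by simp
qed

text \<open>
  The tangent direction is Birkhoff orthogonal to the point, and by \<open>birkhoff_orth_parallel_tangent\<close> it
  is the only such direction; the orientation and the length single out one vector.
\<close>
lemma birkhoff_map_tangent:
  assumes \<phi>: "(\<phi> has_vector_derivative u) (at s)"
    and V: "open V" "s \<in> V" "\<And>t. t \<in> V \<Longrightarrow> \<phi> t \<in> sphere 0 1"
    and pos: "\<omega> (\<phi> s) u > 0"
  shows "birkhoff_map \<omega> (\<phi> s) = u /\<^sub>R norm u"
  unfolding birkhoff_map_def
proof (rule the_equality)
  have u0: "u \<noteq> 0" using pos by (auto simp: \<omega> coordinate_simps)
  have "\<phi> s \<stileturn>\<^sub>B u" using curve_on_sphere_birkhoff_orth[OF \<phi> V] .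
  then have "\<phi> s \<stileturn>\<^sub>B u /\<^sub>R norm u" unfolding birkhoff_orth_def by simp
  then show "u /\<^sub>R norm u \<in> sphere 0 1 \<and> \<phi> s \<stileturn>\<^sub>B u /\<^sub>R norm u \<and> \<omega> (\<phi> s) (u /\<^sub>R norm u) > 0"
    using u0 pos by (simp add: form_simps(3))
  fix w assume w: "w \<in> sphere 0 1 \<and> \<phi> s \<stileturn>\<^sub>B w \<and> \<omega> (\<phi> s) w > 0"
  then have "\<omega> u w = 0" using birkhoff_orth_parallel_tangent[OF \<phi> V, of w] by force
  then have "\<omega> w u = 0" using form_simps(4)[of w u] by linarith
  then obtain k where k: "w = k *\<^sub>R u" using form_0_parallel u0 by blast
  then have "k > 0" using w pos by (simp add: form_simps(3) zero_less_mult_iff)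
  then have "k * norm u = 1" using k w by simp
  then have "k = inverse (norm u)" by (metis inverse_unique inverse_inverse_eq)
  then show "w = u /\<^sub>R norm u" using k by simp
qed

subsection \<open>Parametrization of the unit circle by the angle\<close>

definition radial :: "real \<Rightarrow> real" where "radial \<theta> = inverse (norm (J (cis \<theta>)))"

definition circle :: "real \<Rightarrow> 'a" where "circle \<theta> = J (of_real (radial \<theta>) * cis \<theta>)"

lemma radial_pos [simp]: "radial \<theta> > 0"
  by (simp add: radial_def)

lemma circle_in_sphere [simp]: "circle \<theta> \<in> sphere 0 1"
proof -
  have "circle \<theta> = radial \<theta> *\<^sub>R J (cis \<theta>)" by (simp only: circle_def coordinate_simps)
  then show ?thesis by (simp add: radial_def)
qed

lemma circle_cong: "cis s = cis t \<Longrightarrow> circle s = circle t"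
  by (simp add: circle_def radial_def)

lemma continuous_circle: "continuous_on UNIV circle"
  unfolding circle_def radial_def cis_conv_exp
  by (intro continuous_intros bounded_linear.continuous_on[OF J]) (simp add: cis_conv_exp[symmetric])

lemma sphere_polar:
  assumes "J (exp z) \<in> sphere 0 1"
  shows "radial (Im z) = exp (Re z)" "circle (Im z) = J (exp z)"
proof -
  have e: "exp z = of_real (exp (Re z)) * cis (Im z)" by (simp add: exp_eq_polar)
  have "exp (Re z) * norm (J (cis (Im z))) = 1"
    using assms unfolding e by (simp add: coordinate_simps)
  then show "radial (Im z) = exp (Re z)" by (simp add: radial_def inverse_unique mult.commute)
  then show "circle (Im z) = J (exp z)" unfolding circle_def e by simp
qed

lemma circle_eq_cis:
  assumes "circle s = circle t"
  shows "cis s = cis t"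
proof -
  have "of_real (radial s) * cis s = of_real (radial t) * cis t"
    using assms unfolding circle_def by (metis HJ)
  then show ?thesis by (rule polar_form_unique) simp_all
qed

text \<open>
  The angle of a curve on the unit circle is the imaginary part of a smooth logarithm, shifted by a
  constant multiple of \<open>2\<pi>\<close> to match the initial angle. The real part of the logarithm gives the
  smoothness of \<open>radial \<circ> \<tau>\<close>, before the smoothness of \<open>radial\<close> itself is known.
\<close>
lemma sphere_curve_lift:
  assumes A: "convex A" "\<And>t. t \<in> A \<Longrightarrow> t islimpt A" "a \<in> A"
    and \<eta>: "inf_diff_on A \<eta>" "\<And>t. t \<in> A \<Longrightarrow> \<eta> t \<in> sphere 0 1" "\<eta> a = circle \<theta>\<^sub>0"
  obtains \<tau> where "inf_diff_on A \<tau>" "inf_diff_on A (\<lambda>t. radial (\<tau> t))" "\<tau> a = \<theta>\<^sub>0"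
    "\<And>t. t \<in> A \<Longrightarrow> circle (\<tau> t) = \<eta> t"
proof -
  have "inf_diff_on A (\<lambda>t. H (\<eta> t))" using \<eta>(1) diff_times_on_linear[OF H] by blast
  moreover have "H (\<eta> t) \<noteq> 0" if "t \<in> A" for t using \<eta>(2)[OF that] by auto
  ultimately obtain l where l: "inf_diff_on A l" "\<And>t. t \<in> A \<Longrightarrow> H (\<eta> t) = exp (l t)"
    using smooth_logarithm[OF A(1,2)] by blast
  have J\<eta>: "J (exp (l t)) = \<eta> t" if "t \<in> A" for t using l(2)[OF that] by (metis JH)
  have polar: "circle (Im (l t)) = \<eta> t" "radial (Im (l t)) = exp (Re (l t))" if "t \<in> A" for t
    using sphere_polar[of "l t"] \<eta>(2)[OF that] J\<eta>[OF that] by simp_all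
  define \<tau> where "\<tau> t = Im (l t) + (\<theta>\<^sub>0 - Im (l a))" for t
  have "cis (Im (l a)) = cis \<theta>\<^sub>0" using polar(1)[OF A(3)] \<eta>(3) by (intro circle_eq_cis) simp
  then have cis: "cis (\<tau> t) = cis (Im (l t))" for t
    unfolding \<tau>_def cis_mult[symmetric] cis_divide[symmetric] by simp
  show ?thesis
  proof
    show "inf_diff_on A \<tau>" unfolding \<tau>_def
      using l(1) by (auto intro!: diff_times_on_add diff_times_on_const diff_times_on_linear[OF bounded_linear_Im])
    show "\<tau> a = \<theta>\<^sub>0" by (simp add: \<tau>_def)
    show "circle (\<tau> t) = \<eta> t" if "t \<in> A" for t using circle_cong[OF cis] polar(1)[OF that] by simp
    have rad: "inf_diff_on A (\<lambda>t. exp (Re (l t)))"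
      using l(1) diff_times_on_linear[OF bounded_linear_Re] inf_diff_on_exp by blast
    have eq: "exp (Re (l t)) = radial (\<tau> t)" if "t \<in> A" for t
      using polar(2)[OF that] cis[of t] by (simp add: radial_def)
    show "inf_diff_on A (\<lambda>t. radial (\<tau> t))"
      by (intro allI diff_times_on_cong[OF rad[rule_format] eq])
  qed
qed

lemma circle_has_vector_derivative:
  assumes "((\<lambda>t. radial (\<tau> t)) has_vector_derivative r) F" "(\<tau> has_vector_derivative q) F"
    and "F = at s within A"
  shows "((\<lambda>t. circle (\<tau> t)) has_vector_derivative
      J ((of_real r + \<i> * of_real (q * radial (\<tau> s))) * cis (\<tau> s))) F"
proof -
  have "((\<lambda>t. \<i> * of_real (\<tau> t)) has_vector_derivative \<i> * of_real q) (at s within A)"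
    using bounded_linear.has_vector_derivative[OF bounded_linear_of_real assms(2)[unfolded assms(3)]]
    by (rule has_vector_derivative_mult_right)
  from field_vector_diff_chain_within[OF this has_field_derivative_at_within[OF DERIV_exp]]
  have "((\<lambda>t. exp (\<i> * of_real (\<tau> t))) has_vector_derivative \<i> * of_real q * exp (\<i> * of_real (\<tau> s))) (at s within A)"
    by (simp only: o_def)
  with bounded_linear.has_vector_derivative[OF bounded_linear_of_real assms(1)[unfolded assms(3)]]
  have "((\<lambda>t. of_real (radial (\<tau> t)) * cis (\<tau> t)) has_vector_derivative
      of_real (radial (\<tau> s)) * (\<i> * of_real q * cis (\<tau> s)) + of_real r * cis (\<tau> s)) (at s within A)"
    unfolding cis_conv_exp by (rule has_vector_derivative_mult)
  from bounded_linear.has_vector_derivative[OF J this] show ?thesis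
    unfolding circle_def assms(3) by (simp add: algebra_simps)
qed

text \<open>
  If the angle were stationary, the velocity of \<open>\<phi>\<close> would be a multiple of \<open>\<phi> s\<close>. A
  nonzero tangent vector is Birkhoff orthogonal to \<open>\<phi> s\<close> and hence not parallel to it.
\<close>
lemma lift_regular:
  assumes "open A" "s \<in> A" "\<And>t. t \<in> A \<Longrightarrow> circle (\<tau> t) = \<phi> t"
    and "((\<lambda>t. radial (\<tau> t)) has_vector_derivative r) (at s)" "(\<tau> has_vector_derivative q) (at s)"
    and "(\<phi> has_vector_derivative u) (at s)" "u \<noteq> 0"
  shows "q \<noteq> 0"
proof
  assume "q = 0"
  then have "((\<lambda>t. circle (\<tau> t)) has_vector_derivative J (of_real r * cis (\<tau> s))) (at s)"
    using circle_has_vector_derivative[OF assms(4,5) refl] by simp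
  then have "(\<phi> has_vector_derivative J (of_real r * cis (\<tau> s))) (at s)"
    using assms(1-3) by (rule has_vector_derivative_transform_within_open)
  then have "u = r *\<^sub>R J (cis (\<tau> s))"
    using vector_derivative_unique_at[OF assms(6)] by (simp only: coordinate_simps)
  moreover have "\<phi> s = radial (\<tau> s) *\<^sub>R J (cis (\<tau> s))"
    using assms(3)[OF assms(2)] by (simp only: circle_def coordinate_simps)
  ultimately have "\<omega> (\<phi> s) u = 0" by (simp add: \<omega> coordinate_simps)
  moreover have "\<phi> t \<in> sphere 0 1" if "t \<in> A" for t using assms(3)[OF that] circle_in_sphere by metis
  ultimately show False
    using birkhoff_orth_imp_form_nz[OF curve_on_sphere_birkhoff_orth[OF assms(6,1,2)] _ assms(7)] assms(2)
    by (metis dist_0_norm mem_sphere norm_zero zero_neq_one)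
qed

text \<open>
  Near \<open>\<theta>\<^sub>0\<close> take a regular chart \<open>\<phi>\<close> of the circle and its smooth angle \<open>ang\<close>. The chart parameter \<open>\<sigma> \<theta>\<close> of
  the point \<open>circle \<theta>\<close> is a continuous right inverse of \<open>ang\<close>, hence smooth, and
  \<open>radial = radial \<circ> ang \<circ> \<sigma>\<close> near \<open>\<theta>\<^sub>0\<close>, where \<open>radial \<circ> ang\<close> is smooth by the lifting lemma.
\<close>
lemma radial_smooth:
  assumes sm: "smooth_norm TYPE('a)"
  shows "inf_diff_on UNIV radial"
proof
  fix n
  show "diff_times_on n UNIV radial"
  proof (rule diff_times_on_local)
    fix \<theta>\<^sub>0 :: real
    obtain U a b \<phi> \<psi> where U: "open U" "circle \<theta>\<^sub>0 \<in> U"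
      and sm\<phi>: "smooth_on {a<..<b} \<phi>"
      and reg: "\<And>s. s \<in> {a<..<b} \<Longrightarrow> vector_derivative \<phi> (at s) \<noteq> 0"
      and hom: "homeomorphism {a<..<b} (sphere 0 1 \<inter> U) \<phi> \<psi>"
      using sm[unfolded smooth_norm_def smooth_curve_def, rule_format, of "circle \<theta>\<^sub>0"] circle_in_sphere by metis
    define A where "A = {a<..<b}"
    have A: "open A" "convex A" by (simp_all add: A_def)
    note ilim = islimpt_interval(1)[OF A(1)]
    have \<phi>: "inf_diff_on A \<phi>" using sm\<phi> inf_diff_on_iff[OF ilim, of \<phi>] by (simp add: A_def)
    have \<phi>S: "\<phi> s \<in> sphere 0 1" if "s \<in> A" for s
      using hom that unfolding homeomorphism_def A_def by blast
    have \<psi>: "\<psi> x \<in> A" "\<phi> (\<psi> x) = x" if "x \<in> sphere 0 1 \<inter> U" for x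
      using hom that unfolding homeomorphism_def A_def by blast+
    have x0: "circle \<theta>\<^sub>0 \<in> sphere 0 1 \<inter> U" using U(2) circle_in_sphere by blast
    obtain ang where ang: "inf_diff_on A ang" "inf_diff_on A (\<lambda>t. radial (ang t))"
      "ang (\<psi> (circle \<theta>\<^sub>0)) = \<theta>\<^sub>0" "\<And>t. t \<in> A \<Longrightarrow> circle (ang t) = \<phi> t"
      using sphere_curve_lift[OF A(2) ilim \<psi>(1)[OF x0] \<phi> \<phi>S \<psi>(2)[OF x0]] by blast
    obtain ang' where ang': "\<And>s. s \<in> A \<Longrightarrow> (ang has_vector_derivative ang' s) (at s within A)"
      using inf_diff_onE[OF ang(1)] by blast
    have ang'_nz: "ang' s \<noteq> 0" if s: "s \<in> A" for s
    proof -
      obtain r u where "((\<lambda>t. radial (ang t)) has_vector_derivative r) (at s within A)"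
        "(\<phi> has_vector_derivative u) (at s within A)"
        using inf_diff_onE[OF ang(2)] inf_diff_onE[OF \<phi>] s by metis
      then have ru: "((\<lambda>t. radial (ang t)) has_vector_derivative r) (at s)" "(\<phi> has_vector_derivative u) (at s)"
        by (simp_all only: at_within_open[OF s A(1)])
      have "u \<noteq> 0" using reg[of s] s vector_derivative_at[OF ru(2)] by (simp add: A_def)
      moreover have "(ang has_vector_derivative ang' s) (at s)"
        using ang'[OF s] by (simp only: at_within_open[OF s A(1)])
      ultimately show ?thesis using lift_regular[OF A(1) s ang(4) ru(1) _ ru(2)] by blast
    qed
    define \<sigma> where "\<sigma> \<theta> = \<psi> (circle \<theta>)" for \<theta>
    define W where "W = circle -` U"
    have Wo: "open W" unfolding W_def using continuous_circle U(1)
      by (simp add: continuous_on_eq_continuous_at open_vimage)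
    have W: "circle \<theta> \<in> sphere 0 1 \<inter> U" if "\<theta> \<in> W" for \<theta>
      using that circle_in_sphere unfolding W_def by blast
    then have \<sigma>A: "\<sigma> \<theta> \<in> A" "circle (ang (\<sigma> \<theta>)) = circle \<theta>" if "\<theta> \<in> W" for \<theta>
      using that \<psi> ang(4) by (simp_all only: \<sigma>_def)
    have \<theta>W: "\<theta>\<^sub>0 \<in> W" using U(2) by (simp add: W_def)
    have "continuous_on (sphere 0 1 \<inter> U) \<psi>" using hom unfolding homeomorphism_def by blast
    then have \<sigma>c: "continuous_on W \<sigma>"
      unfolding \<sigma>_def using W
      by (metis continuous_on_compose2 continuous_on_subset[OF continuous_circle subset_UNIV] image_subsetI)
    have "\<sigma> ` W \<subseteq> A" using \<sigma>A(1) by (rule image_subsetI)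
    from continuous_on_compose2[OF inf_diff_on_continuous[OF ang(1)] \<sigma>c this]
    have "continuous_on W (\<lambda>\<theta>. ang (\<sigma> \<theta>) - \<theta>)" by (intro continuous_intros)
    then have "isCont (\<lambda>\<theta>. ang (\<sigma> \<theta>) - \<theta>) \<theta>\<^sub>0" using Wo \<theta>W by (simp add: continuous_on_eq_continuous_at)
    then have "((\<lambda>\<theta>. ang (\<sigma> \<theta>) - \<theta>) \<longlongrightarrow> ang (\<sigma> \<theta>\<^sub>0) - \<theta>\<^sub>0) (nhds \<theta>\<^sub>0)"
      unfolding isCont_def by (rule tendsto_at_iff_tendsto_nhds[where g = "\<lambda>\<theta>. ang (\<sigma> \<theta>) - \<theta>", THEN iffD1])
    moreover have "ang (\<sigma> \<theta>\<^sub>0) - \<theta>\<^sub>0 = 0" using ang(3) by (simp add: \<sigma>_def)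
    ultimately have "\<forall>\<^sub>F \<theta> in nhds \<theta>\<^sub>0. \<bar>ang (\<sigma> \<theta>) - \<theta>\<bar> < 2*pi"
      using tendstoD[of "\<lambda>\<theta>. ang (\<sigma> \<theta>) - \<theta>" 0 "nhds \<theta>\<^sub>0" "2*pi"] by (simp add: dist_norm)
    then obtain V0 where V0: "open V0" "\<theta>\<^sub>0 \<in> V0" "\<And>\<theta>. \<theta> \<in> V0 \<Longrightarrow> \<bar>ang (\<sigma> \<theta>) - \<theta>\<bar> < 2*pi"
      unfolding eventually_nhds by blast
    define V where "V = V0 \<inter> W"
    have V: "open V" "\<theta>\<^sub>0 \<in> V" "V \<subseteq> W" using V0 Wo \<theta>W by (auto simp: V_def)
    \<comment> \<open>the two angles agree up to a multiple of \<open>2\<pi>\<close>, and on \<open>V\<close> they are closer than \<open>2\<pi>\<close>\<close>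
    have inv: "ang (\<sigma> \<theta>) = \<theta>" if "\<theta> \<in> V" for \<theta>
    proof -
      have "cis (ang (\<sigma> \<theta>)) = cis \<theta>" using that V(3) \<sigma>A(2) circle_eq_cis by blast
      then obtain k :: int where k: "ang (\<sigma> \<theta>) = \<theta> + 2 * pi * k"
        unfolding cis_conv_exp exp_eq by (auto simp: complex_eq_iff algebra_simps)
      moreover have "\<bar>ang (\<sigma> \<theta>) - \<theta>\<bar> < 2*pi" using V0(3) that by (simp add: V_def)
      ultimately have "\<bar>real_of_int k\<bar> < 1" by (simp add: abs_mult)
      then have "k = 0" by linarith
      then show ?thesis using k by simp
    qed
    have "(ang has_real_derivative ang' s) (at s)" if "s \<in> A" for s
      using ang'[OF that] by (simp only: at_within_open[OF that A(1)] has_real_derivative_iff_has_vector_derivative)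
    from smooth_right_inverse(1)[OF A(1) ang(1) this ang'_nz V(1) continuous_on_subset[OF \<sigma>c V(3)] _ inv]
    have \<sigma>: "inf_diff_on V \<sigma>" using \<sigma>A(1) V(3) by blast
    have "\<sigma> ` V \<subseteq> A" using \<sigma>A(1) V(3) by blast
    from diff_times_on_compose[OF this ang(2)[rule_format] \<sigma>[rule_format]]
    have "diff_times_on n V (\<lambda>\<theta>. radial (ang (\<sigma> \<theta>)))" .
    then have "diff_times_on n V radial" by (rule diff_times_on_cong) (simp only: inv)
    then show "\<exists>V. open V \<and> \<theta>\<^sub>0 \<in> V \<and> diff_times_on n V radial" using V by blast
  qed
qed

subsection \<open>Motion along the unit circle with prescribed speed\<close>

text \<open>
  The velocity of \<open>circle\<close> is \<open>J w\<close> with \<open>w\<close> smooth. Writing \<open>w = exp l\<close> expresses its norm as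
  \<open>exp (Re l) / radial (Im l)\<close>, which is how the smoothness of \<open>radial\<close> yields that of the norm along
  any nonvanishing smooth curve. The speed is bounded below because the component of \<open>w\<close>
  orthogonal to \<open>cis \<theta>\<close> is \<open>radial \<theta>\<close>, and the norm is equivalent to the modulus.
\<close>
lemma circle_speed:
  assumes sm: "smooth_norm TYPE('a)"
  obtains speed m where
    "inf_diff_on UNIV speed" "m > 0" "\<And>\<theta>. speed \<theta> \<ge> m" "inf_diff_on UNIV circle"
    "\<And>\<theta>. (circle has_vector_derivative speed \<theta> *\<^sub>R birkhoff_map \<omega> (circle \<theta>)) (at \<theta>)"
    "\<And>\<theta>. norm (birkhoff_map \<omega> (circle \<theta>)) = 1"
proof -
  note rad = radial_smooth[OF sm]
  obtain r where r: "\<And>\<theta>. (radial has_vector_derivative r \<theta>) (at \<theta>)"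
    using inf_diff_onE[OF rad] by auto
  define w where "w \<theta> = (of_real (r \<theta>) + \<i> * of_real (radial \<theta>)) * cis \<theta>" for \<theta>
  have c': "(circle has_vector_derivative J (w \<theta>)) (at \<theta>)" for \<theta>
    using circle_has_vector_derivative[of "\<lambda>t. t" "r \<theta>" "at \<theta>" 1 \<theta> UNIV] r by (simp add: w_def)
  have cis: "inf_diff_on UNIV cis"
  proof -
    have "(\<lambda>t. exp (of_real t * \<i>)) = cis" by (simp add: fun_eq_iff cis_conv_exp mult.commute)
    then show ?thesis using inf_diff_on_exp_linear[of UNIV \<i>] by simp
  qed
  have r_smooth: "inf_diff_on UNIV r"
    using inf_diff_on_deriv[OF _ rad] r by auto
  have w: "inf_diff_on UNIV w" unfolding w_def
    by (intro allI diff_times_on_bilinear[OF bounded_bilinear_mult] diff_times_on_add diff_times_on_const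
      diff_times_on_linear[OF bounded_linear_of_real] rad[rule_format] r_smooth[rule_format] cis[rule_format])
  have w_ge: "radial \<theta> \<le> cmod (w \<theta>)" for \<theta>
    using abs_Im_le_cmod[of "of_real (r \<theta>) + \<i> * of_real (radial \<theta>)"] radial_pos[of \<theta>]
    by (simp add: w_def norm_mult)
  then have w0: "w \<theta> \<noteq> 0" for \<theta> using radial_pos[of \<theta>] by (metis norm_zero not_less)
  define speed where "speed \<theta> = norm (J (w \<theta>))" for \<theta>
  obtain l where l: "inf_diff_on UNIV l" "\<And>\<theta>. w \<theta> = exp (l \<theta>)"
    using smooth_logarithm[OF convex_UNIV _ w] w0 by auto
  have speed_eq: "speed \<theta> = exp (Re (l \<theta>)) * inverse (radial (Im (l \<theta>)))" for \<theta>
  proof -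
    have "J (w \<theta>) = exp (Re (l \<theta>)) *\<^sub>R J (cis (Im (l \<theta>)))"
      unfolding l(2) by (simp only: exp_eq_polar coordinate_simps)
    then show ?thesis by (simp add: speed_def radial_def)
  qed
  have e: "inf_diff_on UNIV (\<lambda>\<theta>. exp (Re (l \<theta>)))"
    using l(1) diff_times_on_linear[OF bounded_linear_Re] inf_diff_on_exp by blast
  have i: "inf_diff_on UNIV (\<lambda>\<theta>. inverse (radial (Im (l \<theta>))))"
    using diff_times_on_compose[OF subset_UNIV rad[rule_format] diff_times_on_linear[OF bounded_linear_Im l(1)[rule_format]]]
      radial_pos by (intro allI diff_times_on_inverse) (auto simp: less_imp_neq[symmetric])
  have speed: "inf_diff_on UNIV speed"
    using diff_times_on_bilinear[OF bounded_bilinear_mult e[rule_format] i[rule_format]]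
    unfolding speed_eq[abs_def] by blast
  obtain M where M: "M > 0" "\<And>z. norm (J z) \<le> cmod z * M" using bounded_linear.pos_bounded[OF J] by blast
  obtain K where K: "K > 0" "\<And>x. cmod (H x) \<le> norm x * K" using bounded_linear.pos_bounded[OF H] by blast
  have lower: "inverse M / K \<le> speed \<theta>" for \<theta>
  proof -
    have "inverse M \<le> radial \<theta>" using M(2)[of "cis \<theta>"] unfolding radial_def by (intro le_imp_inverse_le) auto
    also have "\<dots> \<le> cmod (H (J (w \<theta>)))" using w_ge by simp
    also have "\<dots> \<le> speed \<theta> * K" unfolding speed_def by (rule K)
    finally show ?thesis using K(1) by (simp add: divide_le_eq)
  qed
  have bw: "birkhoff_map \<omega> (circle \<theta>) = J (w \<theta>) /\<^sub>R speed \<theta>" for \<theta>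
    unfolding speed_def
  proof (rule birkhoff_map_tangent[OF c' open_UNIV UNIV_I])
    have "Im (cnj (of_real (radial \<theta>) * cis \<theta>) * w \<theta>) = (radial \<theta>)\<^sup>2 * (cos \<theta> * cos \<theta> + sin \<theta> * sin \<theta>)"
      unfolding w_def by (simp add: algebra_simps power2_eq_square del: sin_cos_squared_add3)
    then have "\<omega> (circle \<theta>) (J (w \<theta>)) = d * (radial \<theta>)\<^sup>2"
      unfolding \<omega> circle_def HJ by simp
    then show "\<omega> (circle \<theta>) (J (w \<theta>)) > 0"
      using mult_pos_pos[OF d zero_less_power[OF radial_pos]] by (simp only:)
  qed (rule circle_in_sphere)
  have m: "inverse M / K > 0" using M K by simp
  have "speed \<theta> \<noteq> 0" for \<theta> using lower[of \<theta>] m by linarith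
  with bw have b1: "norm (birkhoff_map \<omega> (circle \<theta>)) = 1" for \<theta>
    by (simp add: speed_def)
  from bw \<open>\<And>\<theta>. speed \<theta> \<noteq> 0\<close> have c'': "(circle has_vector_derivative speed \<theta> *\<^sub>R birkhoff_map \<omega> (circle \<theta>)) (at \<theta>)" for \<theta>
    using c'[of \<theta>] by simp
  have "inf_diff_on UNIV circle" unfolding circle_def
    by (intro allI diff_times_on_linear[OF J] diff_times_on_bilinear[OF bounded_bilinear_mult]
      diff_times_on_linear[OF bounded_linear_of_real] rad[rule_format] cis[rule_format])
  then show ?thesis using that[OF speed m lower] c'' b1 by blast
qed

text \<open>
  With \<open>L\<close> a primitive of the speed of \<open>circle\<close>, a curve \<open>circle \<circ> \<tau>\<close> solves the equation exactly when
  \<open>(L \<circ> \<tau>)' = \<kappa>\<close>. The solution is thus \<open>\<tau> t = P (L \<theta>\<^sub>0 + K t - K 0)\<close> with \<open>P\<close> the inverse of \<open>L\<close> and \<open>K\<close> a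
  primitive of \<open>\<kappa>\<close>, and lifting an arbitrary solution to its angle shows that there is no other.
\<close>
lemma spherical_curve_with_given_speed:
  assumes sm: "smooth_norm TYPE('a)" and c: "c > 0"
    and \<kappa>: "inf_diff_on {0..c} \<kappa>" and v: "v \<in> sphere 0 1"
  obtains \<eta> where "inf_diff_on {0..c} \<eta>" "inf_diff_on {0..c} (\<lambda>t. birkhoff_map \<omega> (\<eta> t))"
    "\<eta> 0 = v" "\<And>t. \<eta> t \<in> sphere 0 1" "\<And>t. \<eta> t \<stileturn>\<^sub>B birkhoff_map \<omega> (\<eta> t)"
    "\<And>t. t \<in> {0..c} \<Longrightarrow> (\<eta> has_vector_derivative \<kappa> t *\<^sub>R birkhoff_map \<omega> (\<eta> t)) (at t within {0..c})"
    "\<forall>\<zeta>. inf_diff_on {0..c} \<zeta> \<and> \<zeta> 0 = v \<and> (\<forall>t\<in>{0..c}. \<zeta> t \<in> sphere 0 1 \<and>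
        (\<zeta> has_vector_derivative \<kappa> t *\<^sub>R birkhoff_map \<omega> (\<zeta> t)) (at t within {0..c})) \<longrightarrow>
      (\<forall>t\<in>{0..c}. \<zeta> t = \<eta> t)"
proof -
  obtain speed m where speed: "inf_diff_on UNIV speed" "m > 0" "\<And>\<theta>. speed \<theta> \<ge> m"
    and circ: "inf_diff_on UNIV circle"
      "\<And>\<theta>. (circle has_vector_derivative speed \<theta> *\<^sub>R birkhoff_map \<omega> (circle \<theta>)) (at \<theta>)"
      "\<And>\<theta>. norm (birkhoff_map \<omega> (circle \<theta>)) = 1"
    using circle_speed[OF sm] by blast
  have speed0: "speed \<theta> \<noteq> 0" for \<theta> using speed(2) speed(3)[of \<theta>] by linarith
  obtain L P where L: "\<And>\<theta>. (L has_real_derivative speed \<theta>) (at \<theta>)"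
    and LP: "\<And>x. L (P x) = x" "\<And>\<theta>. P (L \<theta>) = \<theta>"
    and P: "inf_diff_on UNIV P" "\<And>x. (P has_real_derivative inverse (speed (P x))) (at x)"
    using primitive_inverse[OF speed] by blast
  obtain K where K: "\<And>t. t \<in> {0..c} \<Longrightarrow> (K has_vector_derivative \<kappa> t) (at t within {0..c})"
    using antiderivative_continuous[OF inf_diff_on_continuous[OF \<kappa>]] by blast
  define \<theta>\<^sub>0 where "\<theta>\<^sub>0 = Im (Ln (H v))"
  have "H v \<noteq> 0" using v by auto
  then have "J (exp (Ln (H v))) = v" by simp
  then have \<theta>\<^sub>0: "circle \<theta>\<^sub>0 = v" using sphere_polar(2)[of "Ln (H v)"] v by (simp add: \<theta>\<^sub>0_def)
  define S where "S t = L \<theta>\<^sub>0 + K t - K 0" for t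
  have S': "(S has_vector_derivative \<kappa> t) (at t within {0..c})" if "t \<in> {0..c}" for t
    unfolding S_def using K[OF that] by (auto intro!: derivative_eq_intros)
  define T where "T t = P (S t)" for t
  have "inf_diff_on {0..c} S" using inf_diff_on_if_deriv[OF S' \<kappa>] by blast
  from diff_times_on_compose[OF subset_UNIV P(1)[rule_format] this[rule_format]]
  have T: "inf_diff_on {0..c} T" unfolding T_def by blast
  define \<eta> where "\<eta> t = circle (T t)" for t
  define B where "B t = birkhoff_map \<omega> (\<eta> t)" for t
  have chain: "((\<lambda>t. circle (\<tau> t)) has_vector_derivative
      (q * speed (\<tau> t)) *\<^sub>R birkhoff_map \<omega> (circle (\<tau> t))) (at t within {0..c})"
    if "(\<tau> has_vector_derivative q) (at t within {0..c})" for \<tau> q t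
    using vector_diff_chain_within[OF that has_vector_derivative_at_within[OF circ(2)]] by (simp add: o_def)
  have T': "(T has_vector_derivative \<kappa> t * inverse (speed (T t))) (at t within {0..c})"
    if "t \<in> {0..c}" for t
    using vector_diff_chain_within[OF S'[OF that] has_vector_derivative_at_within[OF
        P(2)[of "S t", unfolded has_real_derivative_iff_has_vector_derivative]]]
    unfolding T_def by (simp add: o_def)
  have \<eta>': "(\<eta> has_vector_derivative \<kappa> t *\<^sub>R B t) (at t within {0..c})" if "t \<in> {0..c}" for t
    using chain[OF T'[OF that]] speed0 unfolding \<eta>_def B_def by (simp add: mult.assoc)
  have "inf_diff_on UNIV (\<lambda>\<theta>. speed \<theta> *\<^sub>R birkhoff_map \<omega> (circle \<theta>))"
    using inf_diff_on_deriv[OF _ circ(1)] circ(2) by auto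
  then have "inf_diff_on UNIV (\<lambda>\<theta>. inverse (speed \<theta>) *\<^sub>R speed \<theta> *\<^sub>R birkhoff_map \<omega> (circle \<theta>))"
    using diff_times_on_bilinear[OF bounded_bilinear_scaleR diff_times_on_inverse[OF speed0 speed(1)[rule_format]]]
    by blast
  then have "inf_diff_on UNIV (\<lambda>\<theta>. birkhoff_map \<omega> (circle \<theta>))" using speed0 by simp
  from diff_times_on_compose[OF subset_UNIV this[rule_format] T[rule_format]]
  have B: "inf_diff_on {0..c} B" unfolding B_def \<eta>_def by blast
  from diff_times_on_compose[OF subset_UNIV circ(1)[rule_format] T[rule_format]]
  have \<eta>: "inf_diff_on {0..c} \<eta>" unfolding \<eta>_def by blast
  have orth: "\<eta> t \<stileturn>\<^sub>B B t" for t
  proof -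
    have "circle (T t) \<stileturn>\<^sub>B speed (T t) *\<^sub>R B t"
      unfolding B_def \<eta>_def by (rule curve_on_sphere_birkhoff_orth[OF circ(2) open_UNIV UNIV_I circle_in_sphere])
    from birkhoff_orth_scaleR[OF this, of "inverse (speed (T t))"] show ?thesis
      using speed0 by (simp add: \<eta>_def)
  qed
  have unique: "\<zeta> t = \<eta> t" if \<zeta>: "inf_diff_on {0..c} \<zeta>" "\<zeta> 0 = v" "\<And>t. t \<in> {0..c} \<Longrightarrow> \<zeta> t \<in> sphere 0 1"
    "\<And>t. t \<in> {0..c} \<Longrightarrow> (\<zeta> has_vector_derivative \<kappa> t *\<^sub>R birkhoff_map \<omega> (\<zeta> t)) (at t within {0..c})"
    and t: "t \<in> {0..c}" for \<zeta> t
  proof -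
    have c0: "0 \<in> {0..c}" using c by simp
    have start: "\<zeta> 0 = circle \<theta>\<^sub>0" using \<zeta>(2) \<theta>\<^sub>0 by simp
    obtain \<tau> where \<tau>: "inf_diff_on {0..c} \<tau>" "\<tau> 0 = \<theta>\<^sub>0" "\<And>t. t \<in> {0..c} \<Longrightarrow> circle (\<tau> t) = \<zeta> t"
      using sphere_curve_lift[OF _ islimpt_interval(2)[OF c] c0 \<zeta>(1,3) start] convex_closed_interval by blast
    obtain q where q: "\<And>t. t \<in> {0..c} \<Longrightarrow> (\<tau> has_vector_derivative q t) (at t within {0..c})"
      using inf_diff_onE[OF \<tau>(1)] by blast
    have q_speed: "q s * speed (\<tau> s) = \<kappa> s" if s: "s \<in> {0..c}" for s
    proof -
      have "(\<zeta> has_vector_derivative (q s * speed (\<tau> s)) *\<^sub>R birkhoff_map \<omega> (\<zeta> s)) (at s within {0..c})"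
        using has_vector_derivative_transform[OF s \<tau>(3)[symmetric] chain[OF q[OF s]]] \<tau>(3)[OF s] by simp
      then have "(q s * speed (\<tau> s)) *\<^sub>R birkhoff_map \<omega> (\<zeta> s) = \<kappa> s *\<^sub>R birkhoff_map \<omega> (\<zeta> s)"
        using \<zeta>(4)[OF s] islimpt_interval(2)[OF c s] by (meson trivial_limit_within vector_derivative_unique_within)
      moreover have "norm (birkhoff_map \<omega> (\<zeta> s)) = 1" using circ(3)[of "\<tau> s"] \<tau>(3)[OF s] by simp
      then have "birkhoff_map \<omega> (\<zeta> s) \<noteq> 0" by force
      ultimately show ?thesis by simp
    qed
    have "((\<lambda>s. L (\<tau> s) - S s) has_vector_derivative 0) (at s within {0..c})" if s: "s \<in> {0..c}" for s
    proof -
      have "((\<lambda>s. L (\<tau> s)) has_vector_derivative q s * speed (\<tau> s)) (at s within {0..c})"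
        using vector_diff_chain_within[OF q[OF s] has_vector_derivative_at_within[OF
            L[of "\<tau> s", unfolded has_real_derivative_iff_has_vector_derivative]]] by (simp add: o_def)
      from has_vector_derivative_diff[OF this S'[OF s]] show ?thesis using q_speed[OF s] by simp
    qed
    then obtain k where k: "\<And>s. s \<in> {0..c} \<Longrightarrow> L (\<tau> s) - S s = k"
      using has_vector_derivative_zero_constant[OF convex_real_interval(5)] by blast
    \<comment> \<open>the constant is 0 because \<open>\<tau>\<close> starts at \<open>\<theta>\<^sub>0\<close>\<close>
    have "L (\<tau> 0) - S 0 = 0" by (simp add: S_def \<tau>(2))
    then have "L (\<tau> t) = S t" using k[OF t] k[OF c0] by simp
    then have "\<tau> t = T t" by (metis LP(2) T_def)
    then show ?thesis using \<tau>(3)[OF t] by (simp add: \<eta>_def)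
  qed
  have "\<eta> 0 = v" by (simp add: \<eta>_def T_def S_def LP \<theta>\<^sub>0)
  moreover have "\<eta> t \<in> sphere 0 1" for t unfolding \<eta>_def by (rule circle_in_sphere)
  ultimately show ?thesis
    using that[of \<eta>] \<eta> B orth \<eta>' unique unfolding B_def[abs_def] by blast
qed

end

section \<open>Existence and uniqueness of Legendre curves\<close>

text \<open>
  For a basis \<open>a, b\<close> with \<open>\<omega> a b = d > 0\<close> the coordinates of a vector \<open>x\<close> are \<open>\<omega> x b / d\<close> and \<open>\<omega> a x / d\<close>.
  They are bounded because the norm attains a positive minimum on the Euclidean unit circle.
\<close>
lemma plane_has_coordinates:
  fixes \<omega> :: "'a::real_normed_vector \<Rightarrow> 'a \<Rightarrow> real"
  assumes dim: "dim (UNIV :: 'a set) = 2" and form: "symplectic_form \<omega>"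
  obtains J H d where "plane_coordinates \<omega> J H d"
proof -
  have bil: "bilinear \<omega>" and alt: "\<omega> x x = 0" and nondeg: "x \<noteq> 0 \<Longrightarrow> \<exists>y. \<omega> x y \<noteq> 0" for x
    using form unfolding symplectic_form_def by blast+
  note bs = bilinear_ladd[OF bil] bilinear_radd[OF bil] bilinear_lmul[OF bil] bilinear_rmul[OF bil] alt
  have anti: "\<omega> x y = - \<omega> y x" for x y 
    using alt[of "x + y"] unfolding bilinear_ladd[OF bil] bilinear_radd[OF bil]
    by (simp add: alt eq_neg_iff_add_eq_0)
  obtain B :: "'a set" where B: "independent B" "UNIV \<subseteq> span B" "card B = 2"
    using basis_exists[of "UNIV :: 'a set"] dim by metis
  obtain a0 b0 where ab0: "B = {a0, b0}" "a0 \<noteq> b0" using B(3) by (auto simp: card_2_iff)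
  have coords0: "\<exists>r s. x = r *\<^sub>R a0 + s *\<^sub>R b0" for x
    using B(2) ab0 by (auto simp: span_insert span_breakdown_eq algebra_simps)
  have "\<omega> a0 b0 \<noteq> 0"
  proof
    assume "\<omega> a0 b0 = 0"
    then have "\<omega> a0 x = 0" for x using coords0[of x] by (auto simp: bs)
    then have "a0 = 0" using nondeg by blast
    then show False using B(1) ab0 dependent_zero by blast
  qed
  define a b where "a = (if \<omega> a0 b0 > 0 then a0 else b0)" and "b = (if \<omega> a0 b0 > 0 then b0 else a0)"
  define d where "d = \<omega> a b"
  have d: "d > 0" using \<open>\<omega> a0 b0 \<noteq> 0\<close> anti[of a0 b0] by (auto simp: d_def a_def b_def)
  have coords: "\<exists>r s. x = r *\<^sub>R a + s *\<^sub>R b" for x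
    using coords0[of x] unfolding a_def b_def by (metis add.commute)
  define J where "J z = Re z *\<^sub>R a + Im z *\<^sub>R b" for z
  define H where "H x = Complex (\<omega> x b / d) (\<omega> a x / d)" for x
  have ba: "\<omega> b a = - d" using anti d_def by metis
  have J\<omega>: "\<omega> (J z) b = Re z * d" "\<omega> a (J z) = Im z * d" for z
    unfolding J_def by (simp_all add: bs d_def)
  have HJ: "H (J z) = z" for z using d by (simp add: H_def J\<omega>)
  have surj: "\<exists>z. x = J z" for x
    using coords[of x] unfolding J_def by (metis complex.sel)
  have JH: "J (H x) = x" for x using surj[of x] HJ by metis
  have J: "bounded_linear J"
    unfolding linear_conv_bounded_linear[symmetric] J_def by (intro linearI) (simp_all add: algebra_simps)
  have "linear H"
    by (intro linearI) (simp_all add: H_def bs complex_eq_iff add_divide_distrib)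
  have "\<exists>K. \<forall>x. cmod (H x) \<le> norm x * K"
  proof -
    have cJ: "continuous_on (sphere 0 1) (\<lambda>z. norm (J z))"
      using bounded_linear.continuous_on[OF J continuous_on_id] continuous_on_norm by blast
    obtain u where u: "u \<in> sphere 0 1" "\<And>z. z \<in> sphere 0 1 \<Longrightarrow> norm (J u) \<le> norm (J z)"
      using continuous_attains_inf[OF compact_sphere _ cJ] by (metis sphere_eq_empty not_one_less_zero)
    have "J u \<noteq> 0"
    proof
      assume "J u = 0"
      moreover have "J 0 = 0" by (simp add: J_def)
      ultimately have "u = 0" using HJ by metis
      then show False using u(1) by simp
    qed
    have "cmod z * norm (J u) \<le> norm (J z)" for z
    proof (cases "z = 0")
      case False
      then have "norm (J u) \<le> norm (J (z /\<^sub>R cmod z))" by (intro u(2)) simp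
      also have "J (z /\<^sub>R cmod z) = J z /\<^sub>R cmod z"
        using bounded_linear.linear[OF J] by (rule linear_scale)
      finally show ?thesis using False by (simp add: field_simps)
    qed (simp add: J_def)
    from this[of "H _", unfolded JH] show ?thesis using \<open>J u \<noteq> 0\<close>
      by (intro exI[of _ "inverse (norm (J u))"] allI) (simp add: divide_inverse[symmetric] le_divide_eq)
  qed
  then have H: "bounded_linear H"
    using \<open>linear H\<close> unfolding bounded_linear_def bounded_linear_axioms_def by blast
  have "\<omega> x y = d * Im (cnj (H x) * H y)" for x y
  proof -
    have "\<omega> (J (H x)) (J (H y)) = Re (H x) * (Im (H y) * d) + Im (H x) * (Re (H y) * (- d))"
      unfolding J_def by (simp add: bs ba flip: d_def)
    then show ?thesis by (simp add: JH algebra_simps)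
  qed
  then have "plane_coordinates \<omega> J H d" using J H HJ JH d by (intro plane_coordinates.intro)
  then show ?thesis by (rule that)
qed

theorem theorem3p2:
  fixes \<omega> :: "'a::real_normed_vector \<Rightarrow> 'a \<Rightarrow> real"
    and c :: real
    and \<alpha> \<kappa> :: "real \<Rightarrow> real"
    and p v :: 'a
  assumes "dim (UNIV :: 'a set) = 2"
    and "smooth_norm TYPE('a)"
    and "strictly_convex_norm TYPE('a)"
    and "symplectic_form \<omega>"
    and "c > 0"
    and "smooth_on {0..c} \<alpha>"
    and "smooth_on {0..c} \<kappa>"
    and "v \<in> sphere 0 1"
  shows "(\<exists>\<gamma> \<eta>. legendre_curve {0..c} \<gamma> \<eta> \<and> has_legendre_curvature \<omega> {0..c} \<gamma> \<eta> \<alpha> \<kappa> \<and>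
                \<gamma> 0 = p \<and> \<eta> 0 = v) \<and>
         (\<forall>\<gamma>\<^sub>1 \<eta>\<^sub>1 \<gamma>\<^sub>2 \<eta>\<^sub>2.
            legendre_curve {0..c} \<gamma>\<^sub>1 \<eta>\<^sub>1 \<and> has_legendre_curvature \<omega> {0..c} \<gamma>\<^sub>1 \<eta>\<^sub>1 \<alpha> \<kappa> \<and>
            \<gamma>\<^sub>1 0 = p \<and> \<eta>\<^sub>1 0 = v \<and>
            legendre_curve {0..c} \<gamma>\<^sub>2 \<eta>\<^sub>2 \<and> has_legendre_curvature \<omega> {0..c} \<gamma>\<^sub>2 \<eta>\<^sub>2 \<alpha> \<kappa> \<and>
            \<gamma>\<^sub>2 0 = p \<and> \<eta>\<^sub>2 0 = v \<longrightarrow>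
            (\<forall>t\<in>{0..c}. \<gamma>\<^sub>1 t = \<gamma>\<^sub>2 t \<and> \<eta>\<^sub>1 t = \<eta>\<^sub>2 t))"
proof -
  have c: "c > 0" by fact
  note lim = islimpt_interval(2)[OF c]
  have \<alpha>: "inf_diff_on {0..c} \<alpha>" and \<kappa>: "inf_diff_on {0..c} \<kappa>"
    using assms(6,7) smooth_on_imp_diff_times_on by blast+
  have vd: "vector_derivative f (at t within {0..c}) = f'"
    if "(f has_vector_derivative f') (at t within {0..c})" "t \<in> {0..c}" for f :: "real \<Rightarrow> 'a" and f' t
    using lim[OF that(2)] that(1) by (meson trivial_limit_within vector_derivative_within)
  obtain J H d where "plane_coordinates \<omega> J H d" using plane_has_coordinates[OF assms(1,4)] by blast
  then interpret plane_coordinates \<omega> J H d .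
  obtain \<eta> where \<eta>: "inf_diff_on {0..c} \<eta>" and B: "inf_diff_on {0..c} (\<lambda>t. birkhoff_map \<omega> (\<eta> t))"
    and \<eta>0: "\<eta> 0 = v" and \<eta>S: "\<And>t. \<eta> t \<in> sphere 0 1" and orth: "\<And>t. \<eta> t \<stileturn>\<^sub>B birkhoff_map \<omega> (\<eta> t)"
    and \<eta>': "\<And>t. t \<in> {0..c} \<Longrightarrow>
      (\<eta> has_vector_derivative \<kappa> t *\<^sub>R birkhoff_map \<omega> (\<eta> t)) (at t within {0..c})"
    and unique: "\<forall>\<zeta>. inf_diff_on {0..c} \<zeta> \<and> \<zeta> 0 = v \<and> (\<forall>t\<in>{0..c}. \<zeta> t \<in> sphere 0 1 \<and>
        (\<zeta> has_vector_derivative \<kappa> t *\<^sub>R birkhoff_map \<omega> (\<zeta> t)) (at t within {0..c})) \<longrightarrow>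
      (\<forall>t\<in>{0..c}. \<zeta> t = \<eta> t)"
    using spherical_curve_with_given_speed[OF assms(2) c \<kappa> assms(8)] by blast
  define g where "g t = \<alpha> t *\<^sub>R birkhoff_map \<omega> (\<eta> t)" for t
  have g: "inf_diff_on {0..c} g" unfolding g_def
    using \<alpha> B diff_times_on_bilinear[OF bounded_bilinear_scaleR] by blast
  \<comment> \<open>integrate in coordinates, where the space is known to be complete\<close>
  then have "continuous_on {0..c} (\<lambda>t. H (g t))"
    using inf_diff_on_continuous bounded_linear.continuous_on[OF H] by blast
  then obtain G where G: "\<And>t. t \<in> {0..c} \<Longrightarrow> (G has_vector_derivative H (g t)) (at t within {0..c})"
    using antiderivative_continuous by blast
  define \<gamma> where "\<gamma> t = p + (J (G t) - J (G 0))" for t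
  have \<gamma>': "(\<gamma> has_vector_derivative g t) (at t within {0..c})" if "t \<in> {0..c}" for t
    unfolding \<gamma>_def using bounded_linear.has_vector_derivative[OF J G[OF that]]
    by (auto intro!: derivative_eq_intros)
  have \<gamma>: "inf_diff_on {0..c} \<gamma>" using inf_diff_on_if_deriv[OF \<gamma>' g] by blast
  have "smooth_on {0..c} \<gamma>" "smooth_on {0..c} \<eta>"
    using diff_times_on_imp_smooth_on[OF lim] \<gamma> \<eta> by blast+
  then have "legendre_curve {0..c} \<gamma> \<eta>"
    unfolding legendre_curve_def using \<eta>S vd[OF \<gamma>'] birkhoff_orth_scaleR[OF orth] by (simp add: g_def)
  moreover have "has_legendre_curvature \<omega> {0..c} \<gamma> \<eta> \<alpha> \<kappa>"
    unfolding has_legendre_curvature_def using vd[OF \<gamma>'] vd[OF \<eta>'] by (simp add: g_def)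
  moreover have "\<gamma> 0 = p" by (simp add: \<gamma>_def)
  moreover have "\<gamma>\<^sub>1 t = \<gamma> t \<and> \<eta>\<^sub>1 t = \<eta> t"
    if leg: "legendre_curve {0..c} \<gamma>\<^sub>1 \<eta>\<^sub>1" and cur: "has_legendre_curvature \<omega> {0..c} \<gamma>\<^sub>1 \<eta>\<^sub>1 \<alpha> \<kappa>"
      and init: "\<gamma>\<^sub>1 0 = p" "\<eta>\<^sub>1 0 = v" and t: "t \<in> {0..c}" for \<gamma>\<^sub>1 \<eta>\<^sub>1 t
  proof -
    have sm: "inf_diff_on {0..c} \<gamma>\<^sub>1" "inf_diff_on {0..c} \<eta>\<^sub>1"
      and sph: "\<And>s. s \<in> {0..c} \<Longrightarrow> \<eta>\<^sub>1 s \<in> sphere 0 1"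
      using leg smooth_on_imp_diff_times_on unfolding legendre_curve_def by blast+
    have der: "(\<eta>\<^sub>1 has_vector_derivative \<kappa> s *\<^sub>R birkhoff_map \<omega> (\<eta>\<^sub>1 s)) (at s within {0..c})"
      "(\<gamma>\<^sub>1 has_vector_derivative \<alpha> s *\<^sub>R birkhoff_map \<omega> (\<eta>\<^sub>1 s)) (at s within {0..c})"
      if s: "s \<in> {0..c}" for s
      using inf_diff_onE[OF sm(1)] inf_diff_onE[OF sm(2)] vd s cur
      unfolding has_legendre_curvature_def by metis+
    have eq: "\<eta>\<^sub>1 s = \<eta> s" if "s \<in> {0..c}" for s
      using unique sm(2) init(2) sph der(1) that by blast
    have "((\<lambda>s. \<gamma>\<^sub>1 s - \<gamma> s) has_vector_derivative 0) (at s within {0..c})" if s: "s \<in> {0..c}" for s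
      using has_vector_derivative_diff[OF der(2)[OF s] \<gamma>'[OF s]] eq[OF s] by (simp add: g_def)
    then obtain k where k: "\<And>s. s \<in> {0..c} \<Longrightarrow> \<gamma>\<^sub>1 s - \<gamma> s = k"
      using has_vector_derivative_zero_constant[OF convex_real_interval(5)] by blast
    have "k = 0" using k[of 0] c init(1) \<open>\<gamma> 0 = p\<close> by simp
    then show ?thesis using k[OF t] eq[OF t] by simp
  qed
  ultimately show ?thesis using \<eta>0 by metis
qed

end
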